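(* Let $p\in (0,1)$, $q=1-p$, and let $u,d$ be real numbers with $0<d\le 1\le u$ and $u\neq d$. Then the expected net profit $G(n,u,d,p)= \mathbb{E}[T(n,u,d,p)]$ after $n$ rounds satisfies $$\lim_{n\rightarrow \infty} G(n,u,d,p)= \begin{cases} 1,&\text{if } u^pd^{q}>1,\\ 0,&\text{if } u^pd^{q}=1,\\ -1,&\text{if } u^pd^{q}<1. \end{cases}$$
   Context: For $n\in\mathbb{N}$, $n\ge 1$, let $X_n^{(p)}$ be a binomially distributed random variable with parameters $n$ and $p$ (the number of heads in $n$ independent coin tosses with heads probability $p$). Let $$\widetilde{k}_0(n,u,d)=\left\lfloor n \cdot \frac{\ln(1/d)}{\ln(u/d)} \right\rfloor\in\{0,\ldots,n\}.$$ The net profit after $n$ rounds (with stake $1$) is the random variable $$T(n,u,d,p)=\sum_{k=0}^{\widetilde{k}_0(n,u,d)}\mathbf{1}\{X_n^{(p)}=k\}\,(u^kd^{n-k}-1)+\mathbf{1}\{X_n^{(p)}\ge \widetilde{k}_0(n,u,d)+1\},$$ where $\mathbf{1}\{\cdot\}$ denotes the indicator function of an event. Thus $$G(n,u,d,p)=\mathbb{E}[T(n,u,d,p)]=-1+\sum_{k=0}^{\widetilde{k}_0(n,u,d)}\binom{n}{k}(pu)^k(qd)^{n-k}+2\sum_{k=\widetilde{k}_0(n,u,d)+1}^{n}\binom{n}{k}p^kq^{n-k}.$$ Sums over empty index ranges are $0$. *)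

theory Defs
  imports "HOL-Probability.Probability"
begin

definition binomially_distributed :: "'a measure \<Rightarrow> nat \<Rightarrow> real \<Rightarrow> ('a \<Rightarrow> nat) \<Rightarrow> bool" where
  "binomially_distributed M n p X \<longleftrightarrow>
     X \<in> measurable M (count_space UNIV) \<and>
     distr M (count_space UNIV) X = measure_pmf (binomial_pmf n p)"

(* For 0 < d \<le> 1 \<le> u and u \<noteq> d the floor lies in {0..n}, so the conversion by nat loses nothing. *)
definition k0 :: "nat \<Rightarrow> real \<Rightarrow> real \<Rightarrow> nat" where
  "k0 n u d = nat \<lfloor>real n * (ln (1 / d) / ln (u / d))\<rfloor>"

definition net_profit :: "nat \<Rightarrow> real \<Rightarrow> real \<Rightarrow> ('a \<Rightarrow> nat) \<Rightarrow> 'a \<Rightarrow> real" where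
  "net_profit n u d X \<omega> =
     (\<Sum>k = 0..k0 n u d. indicator {\<omega>. X \<omega> = k} \<omega> * (u ^ k * d ^ (n - k) - 1)) +
     indicator {\<omega>. X \<omega> \<ge> k0 n u d + 1} \<omega>"

definition expected_net_profit :: "'a measure \<Rightarrow> nat \<Rightarrow> real \<Rightarrow> real \<Rightarrow> ('a \<Rightarrow> nat) \<Rightarrow> real" where
  "expected_net_profit M n u d X = integral\<^sup>L M (net_profit n u d X)"

end

theory Submission
  imports Defs
begin

text \<open>
  Put \<open>L = ln (u / d) > 0\<close> and \<open>\<kappa> = ln (1 / d) / L\<close>. After \<open>k\<close> heads in \<open>n\<close> tosses the logarithm of
  the stake is \<open>Z = L * (k - n * \<kappa>)\<close>, and \<open>k\<close> lies at or below the threshold of the game exactly if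
  \<open>Z \<le> 0\<close>. The net profit is therefore a function of \<open>Z\<close> alone: it is \<open>exp Z - 1\<close> for \<open>Z \<le> 0\<close> and
  \<open>1\<close> for \<open>Z > 0\<close> (\<open>net_profit_eq_capped_payoff\<close>).

  The variable \<open>Z\<close> fluctuates on the scale \<open>sqrt n\<close>, so a negative \<open>Z\<close> is typically very negative and
  the profit is then close to \<open>-1\<close>. In the limit only the sign of \<open>Z\<close> matters, which gives
  \<open>1 - 2 * lim P (Z \<le> 0)\<close>. This is made precise by squeezing the expectation between
  \<open>1 - 2 * P (Z \<le> 0)\<close> and \<open>1 - P (Z \<le> 0) - (1 - exp s) * P (Z \<le> s)\<close> for \<open>s = c * sqrt n\<close> with
  \<open>c < 0\<close>; first \<open>n\<close> tends to infinity, which kills \<open>exp s\<close>, and then \<open>c\<close> tends to \<open>0\<close>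
  (\<open>expectation_capped_payoff_tendsto\<close>).

  The limits of \<open>P (Z \<le> c * sqrt n)\<close> come from the theorem of de Moivre and Laplace
  (\<open>binomial_prob_tendsto\<close>): the drift \<open>n * L * (p - \<kappa>)\<close> of \<open>Z\<close> dominates the fluctuations unless
  \<open>p = \<kappa>\<close>, so the limit is \<open>0\<close> for \<open>p > \<kappa>\<close> and \<open>1\<close> for \<open>p < \<kappa>\<close>, whereas for \<open>p = \<kappa>\<close> it is a value
  of the normal distribution function, equal to \<open>1 / 2\<close> at \<open>c = 0\<close>. Finally
  \<open>u powr p * d powr q = exp (L * (p - \<kappa>))\<close>, so the three cases are those of the theorem.
\<close>

section \<open>The theorem of de Moivre and Laplace\<close>

lemma char_bernoulli:
  assumes p: "p \<in> {0..1}"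
  shows "char (distr (measure_pmf (bernoulli_pmf p)) borel of_bool) t =
    complex_of_real p * iexp t + complex_of_real (1 - p)"
  using p by (simp add: char_def integral_distr)
    (subst integral_measure_pmf[of UNIV]; simp add: UNIV_bool scaleR_conv_of_real)

lemma char_binomial:
  assumes p: "p \<in> {0..1}"
  shows "char (distr (measure_pmf (binomial_pmf n p)) borel real) t =
    (complex_of_real p * iexp t + complex_of_real (1 - p)) ^ n"
proof -
  have "char (distr (measure_pmf (binomial_pmf n p)) borel real) t =
      (\<Sum>k\<le>n. (real (n choose k) * p ^ k * (1 - p) ^ (n - k)) *\<^sub>R iexp (t * real k))"
    using p by (simp add: char_def integral_distr expectation_binomial_pmf')
  also have "\<dots> = (\<Sum>k\<le>n. of_nat (n choose k) * (complex_of_real p * iexp t) ^ k *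
      complex_of_real (1 - p) ^ (n - k))"
    by (intro sum.cong refl)
      (simp add: scaleR_conv_of_real power_mult_distrib exp_of_nat_mult[symmetric] mult_ac)
  also have "\<dots> = (complex_of_real p * iexp t + complex_of_real (1 - p)) ^ n"
    by (rule binomial_ring[symmetric])
  finally show ?thesis .
qed

lemma indep_vars_PiM_components:
  fixes M :: "'i \<Rightarrow> 'b measure"
  assumes M: "\<And>i. prob_space (M i)"
  shows "prob_space.indep_vars (PiM UNIV M) M (\<lambda>i \<omega>. \<omega> i) UNIV"
proof -
  interpret P: prob_space "PiM UNIV M"
    by (rule prob_space_PiM) (rule M)
  have "distr (PiM UNIV M) (M i) (\<lambda>\<omega>. \<omega> i) = M i" for i
    by (rule distr_PiM_component) (auto intro: M)
  then show ?thesis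
    by (subst P.indep_vars_iff_distr_eq_PiM') (simp_all add: restrict_UNIV distr_id2)
qed

text \<open>
  The central limit theorem speaks of the partial sums of one infinite sequence of independent
  variables. The sequence is realised as the coordinates of an infinite product of Bernoulli
  measures; its partial sums are binomially distributed because the characteristic functions agree.
\<close>

theorem de_Moivre_Laplace:
  assumes p: "0 < p" "p < 1"
  shows "weak_conv_m
    (\<lambda>n. distr (measure_pmf (binomial_pmf n p)) borel
      (\<lambda>k. (real k - real n * p) / sqrt (real n * (p * (1 - p)))))
    std_normal_distribution"
proof -
  define C where "C = PiM UNIV (\<lambda>_::nat. measure_pmf (bernoulli_pmf p))"
  define X :: "nat \<Rightarrow> (nat \<Rightarrow> bool) \<Rightarrow> real" where "X i \<omega> = of_bool (\<omega> i)" for i \<omega>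
  define \<mu> where "\<mu> = distr (measure_pmf (bernoulli_pmf p)) borel (of_bool :: bool \<Rightarrow> real)"
  interpret C: prob_space C
    unfolding C_def by (rule prob_space_PiM) (rule measure_pmf.prob_space_axioms)
  have coord: "distr C (measure_pmf (bernoulli_pmf p)) (\<lambda>\<omega>. \<omega> i) = measure_pmf (bernoulli_pmf p)" for i
    unfolding C_def by (rule distr_PiM_component) (auto simp: measure_pmf.prob_space_axioms)
  have coord_meas: "(\<lambda>\<omega>. \<omega> i) \<in> measurable C (measure_pmf (bernoulli_pmf p))" for i
    unfolding C_def by (rule measurable_component_singleton) simp
  have X_meas [measurable]: "X i \<in> borel_measurable C" for i
    unfolding X_def by (rule measurable_compose[OF coord_meas]) simp
  have X_distr: "distr C borel (X i) = \<mu>" for i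
    unfolding \<mu>_def X_def
    by (subst coord[of i, symmetric], subst distr_distr) (simp_all add: coord_meas[simplified] comp_def)
  have X_indep: "C.indep_vars (\<lambda>_. borel) X UNIV"
    unfolding X_def[abs_def]
    by (rule C.indep_vars_compose2[where M' = "\<lambda>_. measure_pmf (bernoulli_pmf p)"])
      (auto simp: C_def intro!: indep_vars_PiM_components measure_pmf.prob_space_axioms)
  have X_exp: "C.expectation (\<lambda>\<omega>. h (X i \<omega>)) = h 1 * p + h 0 * (1 - p)"
    if [measurable]: "h \<in> borel_measurable borel" for h :: "real \<Rightarrow> real" and i
  proof -
    have "C.expectation (\<lambda>\<omega>. h (X i \<omega>)) = integral\<^sup>L \<mu> h"
      by (subst X_distr[of i, symmetric], subst integral_distr) simp_all
    then show ?thesis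
      using p by (simp add: \<mu>_def integral_distr)
  qed
  have mean: "C.expectation (X i) = p" for i
    using X_exp[of "\<lambda>x. x" i] by simp
  have var: "C.variance (X i) = (sqrt (p * (1 - p)))\<^sup>2" for i
    using X_exp[of "\<lambda>x. (x - p)\<^sup>2" i] p
    by (simp add: mean power2_eq_square algebra_simps)
  have sqi: "integrable C (\<lambda>\<omega>. (X i \<omega>)\<^sup>2)" for i
  proof (rule C.integrable_const_bound[where B = 1])
    show "AE \<omega> in C. norm ((X i \<omega>)\<^sup>2) \<le> 1"
      by (simp add: X_def)
  qed measurable
  have clt: "weak_conv_m (\<lambda>n. distr C borel
      (\<lambda>\<omega>. (\<Sum>i<n. X i \<omega> - p) / sqrt (n * (sqrt (p * (1 - p)))\<^sup>2))) std_normal_distribution"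
    by (rule C.central_limit_theorem[OF X_indep mean _ sqi var X_distr]) (use p in simp)
  have sum_distr: "distr C borel (\<lambda>\<omega>. \<Sum>i<n. X i \<omega>) = distr (measure_pmf (binomial_pmf n p)) borel real"
    for n
  proof (rule Levy_uniqueness)
    show "char (distr C borel (\<lambda>\<omega>. \<Sum>i<n. X i \<omega>)) =
        char (distr (measure_pmf (binomial_pmf n p)) borel real)"
    proof
      fix t
      have "char (distr C borel (\<lambda>\<omega>. \<Sum>i<n. X i \<omega>)) t = (\<Prod>i<n. char (distr C borel (X i)) t)"
        by (rule C.char_distr_sum) (rule C.indep_vars_subset[OF X_indep], simp)
      also have "\<dots> = char (distr (measure_pmf (binomial_pmf n p)) borel real) t"
        using p by (simp add: X_distr \<mu>_def char_bernoulli char_binomial)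
      finally show "char (distr C borel (\<lambda>\<omega>. \<Sum>i<n. X i \<omega>)) t =
        char (distr (measure_pmf (binomial_pmf n p)) borel real) t" .
    qed
  qed (simp_all add: prob_space.real_distribution_distr[OF measure_pmf.prob_space_axioms])
  have "distr C borel (\<lambda>\<omega>. (\<Sum>i<n. X i \<omega> - p) / sqrt (n * (sqrt (p * (1 - p)))\<^sup>2)) =
      distr (measure_pmf (binomial_pmf n p)) borel
        (\<lambda>k. (real k - real n * p) / sqrt (real n * (p * (1 - p))))" (is "?l = ?r") for n
  proof -
    let ?g = "\<lambda>x. (x - real n * p) / sqrt (real n * (p * (1 - p)))"
    have "?l = distr (distr C borel (\<lambda>\<omega>. \<Sum>i<n. X i \<omega>)) borel ?g"
      using p by (subst distr_distr) (simp_all add: comp_def sum_subtractf)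
    also have "\<dots> = ?r"
      unfolding sum_distr by (subst distr_distr) (simp_all add: comp_def)
    finally show ?thesis .
  qed
  with clt show ?thesis by simp
qed

section \<open>The standard normal distribution function\<close>

lemma std_normal_singleton: "measure std_normal_distribution {x} = 0"
proof -
  have "emeasure std_normal_distribution {x} = 0"
    by (subst emeasure_density)
      (auto simp: nn_integral_0_iff_AE intro!: AE_mp[OF AE_lborel_singleton[of x]] split: split_indicator)
  then show ?thesis by (simp add: measure_def)
qed

lemma isCont_cdf_std_normal: "isCont (cdf std_normal_distribution) x"
proof -
  interpret real_distribution std_normal_distribution by (rule real_dist_normal_dist)
  show ?thesis by (simp add: isCont_cdf std_normal_singleton)
qed

text \<open>
  The normal distribution is symmetric, because its characteristic function is even, and it has no
  atom at \<open>0\<close>; so both half lines have equal mass.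
\<close>

lemma cdf_std_normal_0: "cdf std_normal_distribution 0 = 1 / 2"
proof -
  interpret real_distribution std_normal_distribution by (rule real_dist_normal_dist)
  have "distr std_normal_distribution borel uminus = std_normal_distribution"
  proof (rule Levy_uniqueness)
    show "char (distr std_normal_distribution borel uminus) = char std_normal_distribution"
    proof
      fix t
      have "char (distr std_normal_distribution borel uminus) t = char std_normal_distribution (- t)"
        by (simp add: char_def integral_distr)
      then show "char (distr std_normal_distribution borel uminus) t = char std_normal_distribution t"
        by (simp add: char_std_normal_distribution)
    qed
  qed (simp_all add: real_dist_normal_dist)
  then have "prob {0..} = measure (distr std_normal_distribution borel uminus) {0..}"
    by simp
  also have "\<dots> = prob {..0}"
    by (subst measure_distr) (auto intro!: arg_cong[where f = prob])
  finally have sym: "prob {0..} = prob {..0}" .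
  have "({..0} \<union> {0<..} :: real set) = UNIV"
    by auto
  then have "1 = prob ({..0} \<union> {0<..})"
    using prob_space by simp
  also have "\<dots> = prob {..0} + prob {0<..}"
    by (rule finite_measure_Union) auto
  also have "prob {0..} = prob ({0} \<union> {0<..})"
    by (rule arg_cong[where f = prob]) auto
  then have "prob {0<..} = prob {0..}"
    by (subst (asm) finite_measure_Union) (auto simp: std_normal_singleton)
  finally show ?thesis
    using sym by (simp add: cdf_def)
qed

section \<open>Distribution functions at arguments that tend to infinity\<close>

text \<open>
  The limit \<open>R\<close> is a probability measure, so no mass escapes to infinity: a fixed \<open>x\<close> far to the left
  already makes \<open>cdf R x\<close> small, and \<open>a n\<close> is eventually below \<open>x\<close>.
\<close>

lemma cdf_tendsto_0_of_at_bot: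
  assumes F: "\<And>n. real_distribution (N n)" and R: "real_distribution R"
    and conv: "\<And>x. (\<lambda>n. cdf (N n) x) \<longlonglongrightarrow> cdf R x"
    and a: "filterlim a at_bot sequentially"
  shows "(\<lambda>n. cdf (N n) (a n)) \<longlonglongrightarrow> 0"
proof -
  interpret R: real_distribution R by fact
  interpret N: real_distribution "N n" for n by (rule F)
  show ?thesis
  proof (rule order_tendstoI)
    fix e :: real assume "0 < e"
    with R.cdf_lim_at_bot have "eventually (\<lambda>x. cdf R x < e) at_bot"
      by (rule order_tendstoD)
    then obtain x where "cdf R x < e"
      by (auto simp: eventually_at_bot_linorder)
    then have "eventually (\<lambda>n. cdf (N n) x < e) sequentially"
      by (rule order_tendstoD(2)[OF conv])
    moreover have "eventually (\<lambda>n. a n \<le> x) sequentially"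
      using a by (simp add: filterlim_at_bot)
    ultimately show "eventually (\<lambda>n. cdf (N n) (a n) < e) sequentially"
      by eventually_elim (meson N.cdf_nondecreasing le_less_trans)
  next
    fix e :: real assume "e < 0"
    then show "eventually (\<lambda>n. e < cdf (N n) (a n)) sequentially"
      by (auto intro!: always_eventually less_le_trans[OF _ N.cdf_nonneg])
  qed
qed

lemma cdf_tendsto_1_of_at_top:
  assumes F: "\<And>n. real_distribution (N n)" and R: "real_distribution R"
    and conv: "\<And>x. (\<lambda>n. cdf (N n) x) \<longlonglongrightarrow> cdf R x"
    and a: "filterlim a at_top sequentially"
  shows "(\<lambda>n. cdf (N n) (a n)) \<longlonglongrightarrow> 1"
proof -
  interpret R: real_distribution R by fact
  interpret N: real_distribution "N n" for n by (rule F)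
  show ?thesis
  proof (rule order_tendstoI)
    fix e :: real assume "e < 1"
    with R.cdf_lim_at_top_prob have "eventually (\<lambda>x. e < cdf R x) at_top"
      by (rule order_tendstoD)
    then obtain x where "e < cdf R x"
      by (auto simp: eventually_at_top_linorder)
    then have "eventually (\<lambda>n. e < cdf (N n) x) sequentially"
      by (rule order_tendstoD(1)[OF conv])
    moreover have "eventually (\<lambda>n. x \<le> a n) sequentially"
      using a by (simp add: filterlim_at_top)
    ultimately show "eventually (\<lambda>n. e < cdf (N n) (a n)) sequentially"
      by eventually_elim (meson N.cdf_nondecreasing less_le_trans)
  next
    fix e :: real assume "1 < e"
    then show "eventually (\<lambda>n. cdf (N n) (a n) < e) sequentially"
      by (auto intro!: always_eventually le_less_trans[OF N.cdf_bounded_prob])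
  qed
qed

section \<open>The payoff as a function of the logarithm of the stake\<close>

text \<open>The argument is the logarithm of the stake \<open>u ^ k * d ^ (n - k)\<close> left after \<open>k\<close> heads.\<close>

definition capped_payoff :: "real \<Rightarrow> real" where
  "capped_payoff z = (if z \<le> 0 then exp z - 1 else 1)"

lemma capped_payoff_measurable [measurable]: "capped_payoff \<in> borel_measurable borel"
  unfolding capped_payoff_def[abs_def] by measurable

text \<open>
  The lower bound replaces every payoff with \<open>z \<le> 0\<close> by the total loss \<open>-1\<close>; the upper bound
  ignores the losses with \<open>z\<close> in \<open>{s<..0}\<close> and uses that the payoff is at most \<open>exp s - 1\<close> on
  \<open>{..s}\<close>.
\<close>

lemma capped_payoff_bounds:
  shows "1 - 2 * indicator {..0} z \<le> capped_payoff z"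
    and "s \<le> 0 \<Longrightarrow> capped_payoff z \<le> 1 - indicator {..0} z - (1 - exp s) * indicator {..s} z"
  by (auto simp: capped_payoff_def indicator_def)

lemma (in prob_space) expectation_capped_payoff_bounds:
  assumes [measurable]: "Z \<in> borel_measurable M"
  shows "1 - 2 * prob {\<omega>\<in>space M. Z \<omega> \<le> 0} \<le> expectation (\<lambda>\<omega>. capped_payoff (Z \<omega>))"
    and "s \<le> 0 \<Longrightarrow> expectation (\<lambda>\<omega>. capped_payoff (Z \<omega>)) \<le>
      1 - prob {\<omega>\<in>space M. Z \<omega> \<le> 0} - (1 - exp s) * prob {\<omega>\<in>space M. Z \<omega> \<le> s}"
proof -
  have int: "integrable M (\<lambda>\<omega>. capped_payoff (Z \<omega>))"
    by (rule integrable_const_bound[where B = 1]) (auto simp: capped_payoff_def)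
  have inti: "integrable M (\<lambda>\<omega>. indicator {..s} (Z \<omega>) :: real)" for s
    by (rule integrable_const_bound[where B = 1]) (auto simp: indicator_def)
  have prob_eq: "expectation (\<lambda>\<omega>. indicator {..s} (Z \<omega>)) = prob {\<omega>\<in>space M. Z \<omega> \<le> s}" for s
  proof -
    have "expectation (\<lambda>\<omega>. indicator {..s} (Z \<omega>)) =
        expectation (indicator {\<omega>\<in>space M. Z \<omega> \<le> s} :: _ \<Rightarrow> real)"
      by (intro Bochner_Integration.integral_cong) (auto simp: indicator_def)
    then show ?thesis by simp
  qed
  have "expectation (\<lambda>\<omega>. 1 - 2 * indicator {..0} (Z \<omega>)) \<le> expectation (\<lambda>\<omega>. capped_payoff (Z \<omega>))"
    by (intro integral_mono int Bochner_Integration.integrable_diff integrable_mult_right inti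
        capped_payoff_bounds) simp
  then show "1 - 2 * prob {\<omega>\<in>space M. Z \<omega> \<le> 0} \<le> expectation (\<lambda>\<omega>. capped_payoff (Z \<omega>))"
    by (simp add: inti prob_eq prob_space)
  assume s: "s \<le> 0"
  have "expectation (\<lambda>\<omega>. capped_payoff (Z \<omega>)) \<le>
      expectation (\<lambda>\<omega>. 1 - indicator {..0} (Z \<omega>) - (1 - exp s) * indicator {..s} (Z \<omega>))"
    by (intro integral_mono int Bochner_Integration.integrable_diff integrable_mult_right inti
        capped_payoff_bounds s) simp
  then show "expectation (\<lambda>\<omega>. capped_payoff (Z \<omega>)) \<le>
      1 - prob {\<omega>\<in>space M. Z \<omega> \<le> 0} - (1 - exp s) * prob {\<omega>\<in>space M. Z \<omega> \<le> s}"
    by (simp add: inti prob_eq prob_space)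
qed

text \<open>
  If \<open>Z n\<close> is at least of order \<open>sqrt n\<close>, then its payoff is asymptotically its sign. Left
  continuity of \<open>H\<close> at \<open>0\<close> excludes that a positive share of the mass sits just below \<open>0\<close>, where the
  payoff is close to \<open>0\<close> rather than to \<open>-1\<close>.
\<close>

lemma expectation_capped_payoff_tendsto:
  fixes Z :: "nat \<Rightarrow> 'a \<Rightarrow> real"
  assumes N: "\<And>n. prob_space (N n)" and Z: "\<And>n. Z n \<in> borel_measurable (N n)"
    and lim: "\<And>c. c \<le> 0 \<Longrightarrow>
      (\<lambda>n. measure (N n) {\<omega>\<in>space (N n). Z n \<omega> \<le> c * sqrt (real n)}) \<longlonglongrightarrow> H c"
    and H: "(H \<longlongrightarrow> H 0) (at_left 0)"
  shows "(\<lambda>n. integral\<^sup>L (N n) (\<lambda>\<omega>. capped_payoff (Z n \<omega>))) \<longlonglongrightarrow> 1 - 2 * H 0"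
proof -
  let ?P = "\<lambda>c n. measure (N n) {\<omega>\<in>space (N n). Z n \<omega> \<le> c * sqrt (real n)}"
  have lower: "1 - 2 * ?P 0 n \<le> integral\<^sup>L (N n) (\<lambda>\<omega>. capped_payoff (Z n \<omega>))" for n
    using prob_space.expectation_capped_payoff_bounds(1)[OF N Z, of n] by simp
  have upper: "integral\<^sup>L (N n) (\<lambda>\<omega>. capped_payoff (Z n \<omega>)) \<le>
      1 - ?P 0 n - (1 - exp (c * sqrt (real n))) * ?P c n" if "c < 0" for c n
    using prob_space.expectation_capped_payoff_bounds(2)[OF N Z, of "c * sqrt (real n)" n] that
    by (simp add: mult_nonpos_nonneg)
  show ?thesis
  proof (rule order_tendstoI)
    fix a assume a: "a < 1 - 2 * H 0"
    have "(\<lambda>n. 1 - 2 * ?P 0 n) \<longlonglongrightarrow> 1 - 2 * H 0"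
      by (intro tendsto_intros lim) simp
    from order_tendstoD(1)[OF this a]
    show "eventually (\<lambda>n. a < integral\<^sup>L (N n) (\<lambda>\<omega>. capped_payoff (Z n \<omega>))) sequentially"
      by eventually_elim (rule less_le_trans[OF _ lower])
  next
    fix a assume a: "1 - 2 * H 0 < a"
    have "((\<lambda>c. 1 - H 0 - H c) \<longlongrightarrow> 1 - H 0 - H 0) (at_left 0)"
      by (intro tendsto_intros H)
    then have "eventually (\<lambda>c. 1 - H 0 - H c < a) (at_left 0)"
      by (rule order_tendstoD) (use a in simp)
    moreover have "eventually (\<lambda>c::real. c < 0) (at_left 0)"
      by (simp add: eventually_at_filter)
    ultimately have "eventually (\<lambda>c. 1 - H 0 - H c < a \<and> c < 0) (at_left 0)"
      by eventually_elim simp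
    \<comment> \<open>Such a \<open>c\<close> makes the limit of the upper bound smaller than \<open>a\<close>.\<close>
    then obtain c where c: "1 - H 0 - H c < a" "c < 0"
      using eventually_happens'[OF trivial_limit_at_left_real] by blast
    have "filterlim (\<lambda>n. c * sqrt (real n)) at_bot sequentially"
      using c(2) by (intro filterlim_tendsto_neg_mult_at_bot[OF tendsto_const])
        (auto intro!: filterlim_compose[OF sqrt_at_top] filterlim_real_sequentially)
    then have "(\<lambda>n. exp (c * sqrt (real n))) \<longlonglongrightarrow> 0"
      by (rule filterlim_compose[OF exp_at_bot])
    then have "(\<lambda>n. 1 - ?P 0 n - (1 - exp (c * sqrt (real n))) * ?P c n) \<longlonglongrightarrow> 1 - H 0 - (1 - 0) * H c"
      by (intro tendsto_intros lim) (use c in auto)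
    then have "eventually (\<lambda>n. 1 - ?P 0 n - (1 - exp (c * sqrt (real n))) * ?P c n < a) sequentially"
      by (rule order_tendstoD) (use c in simp)
    then show "eventually (\<lambda>n. integral\<^sup>L (N n) (\<lambda>\<omega>. capped_payoff (Z n \<omega>)) < a) sequentially"
      by eventually_elim (rule le_less_trans[OF upper[OF c(2)]])
  qed
qed

section \<open>The net profit of the game\<close>

lemma net_profit_eq_capped_payoff:
  assumes d: "0 < d" "d \<le> 1" and u: "1 \<le> u" and ud: "u \<noteq> d"
    and kn: "X \<omega> \<le> n"
  shows "net_profit n u d X \<omega> =
    capped_payoff (ln (u / d) * (real (X \<omega>) - real n * (ln (1 / d) / ln (u / d))))"
proof -
  let ?k = "X \<omega>" and ?L = "ln (u / d)" and ?\<kappa> = "ln (1 / d) / ln (u / d)"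
  have L: "0 < ?L" using assms by (intro ln_gt_zero) simp
  have \<kappa>: "0 \<le> ?\<kappa>" using L d by (intro divide_nonneg_pos) (simp_all add: ln_div)
  have k0: "?k \<le> k0 n u d \<longleftrightarrow> ?L * (real ?k - real n * ?\<kappa>) \<le> 0"
  proof -
    have "0 \<le> \<lfloor>real n * ?\<kappa>\<rfloor>"
      unfolding zero_le_floor by (rule mult_nonneg_nonneg[OF of_nat_0_le_iff \<kappa>])
    then have "?k \<le> k0 n u d \<longleftrightarrow> int ?k \<le> \<lfloor>real n * ?\<kappa>\<rfloor>"
      unfolding k0_def by (rule le_nat_iff)
    also have "\<dots> \<longleftrightarrow> real ?k \<le> real n * ?\<kappa>"
      unfolding le_floor_iff of_int_of_nat_eq ..
    also have "\<dots> \<longleftrightarrow> ?L * (real ?k - real n * ?\<kappa>) \<le> 0"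
      using L by (simp add: mult_le_0_iff)
    finally show ?thesis .
  qed
  have "?L * (real ?k - real n * ?\<kappa>) = real ?k * ?L - real n * (?L * ?\<kappa>)"
    by (simp only: algebra_simps)
  also have "?L * ?\<kappa> = - ln d"
    using L d by (simp add: ln_div[of 1 d])
  also have "real ?k * ?L - real n * (- ln d) = real ?k * ln u + real (n - ?k) * ln d"
    using d u kn by (simp add: of_nat_diff ln_div algebra_simps)
  finally have "?L * (real ?k - real n * ?\<kappa>) = real ?k * ln u + real (n - ?k) * ln d" .
  then have pay: "u ^ ?k * d ^ (n - ?k) = exp (?L * (real ?k - real n * ?\<kappa>))"
    using d u by (simp add: exp_add exp_of_nat_mult)
  have "(\<Sum>k = 0..k0 n u d. indicator {\<omega>. X \<omega> = k} \<omega> * (u ^ k * d ^ (n - k) - 1)) =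
      (\<Sum>k = 0..k0 n u d. if k = ?k then u ^ ?k * d ^ (n - ?k) - 1 else 0)"
    by (intro sum.cong) auto
  also have "\<dots> = (if ?k \<le> k0 n u d then u ^ ?k * d ^ (n - ?k) - 1 else 0)"
    by (simp add: sum.delta)
  finally show ?thesis
    unfolding net_profit_def capped_payoff_def k0[symmetric] pay[symmetric]
    by (auto simp: indicator_def)
qed

lemma expected_net_profit_eq:
  assumes p: "0 < p" "p < 1"
    and d: "0 < d" "d \<le> 1" and u: "1 \<le> u" and ud: "u \<noteq> d"
    and X: "binomially_distributed M n p X"
  shows "expected_net_profit M n u d X =
    measure_pmf.expectation (binomial_pmf n p)
      (\<lambda>k. capped_payoff (ln (u / d) * (real k - real n * (ln (1 / d) / ln (u / d)))))"
proof -
  have "expected_net_profit M n u d X = integral\<^sup>L M (\<lambda>\<omega>. net_profit n u d (\<lambda>k. k) (X \<omega>))"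
    unfolding expected_net_profit_def
    by (rule arg_cong[where f = "integral\<^sup>L M"]) (simp add: fun_eq_iff net_profit_def indicator_def)
  also have "\<dots> = integral\<^sup>L (distr M (count_space UNIV) X) (net_profit n u d (\<lambda>k. k))"
    using X by (subst integral_distr) (simp_all add: binomially_distributed_def)
  also have "\<dots> = measure_pmf.expectation (binomial_pmf n p) (net_profit n u d (\<lambda>k. k))"
    using X by (simp add: binomially_distributed_def)
  also have "\<dots> = measure_pmf.expectation (binomial_pmf n p)
      (\<lambda>k. capped_payoff (ln (u / d) * (real k - real n * (ln (1 / d) / ln (u / d)))))"
    using p by (intro integral_cong_AE) 
      (auto simp: AE_measure_pmf_iff simp del: times_divide_eq_right
        intro!: net_profit_eq_capped_payoff[where X = "\<lambda>k. k"] d u ud)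
  finally show ?thesis .
qed

text \<open>
  After standardisation the event says that the normalised number of heads is at most
  \<open>(c / L + sqrt n * (\<kappa> - p)) / sqrt (p * (1 - p))\<close>. This bound tends to \<open>-\<infinity>\<close> or \<open>\<infinity>\<close> unless
  \<open>\<kappa> = p\<close>, in which case it does not depend on \<open>n\<close>.
\<close>

lemma binomial_prob_tendsto:
  fixes p \<kappa> L c :: real
  assumes p: "0 < p" "p < 1" and L: "0 < L"
  shows "(\<lambda>n. measure_pmf.prob (binomial_pmf n p)
      {k. L * (real k - real n * \<kappa>) \<le> c * sqrt (real n)})
    \<longlonglongrightarrow> (if \<kappa> < p then 0
       else if p < \<kappa> then 1
       else cdf std_normal_distribution (c / (L * sqrt (p * (1 - p)))))"
    (is "?P \<longlonglongrightarrow> ?H")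
proof -
  define \<sigma> where "\<sigma> = sqrt (p * (1 - p))"
  have \<sigma>: "0 < \<sigma>" using p by (simp add: \<sigma>_def)
  define N where "N n = distr (measure_pmf (binomial_pmf n p)) borel
      (\<lambda>k. (real k - real n * p) / sqrt (real n * (p * (1 - p))))" for n
  define a where "a n = (c / L + sqrt (real n) * (\<kappa> - p)) / \<sigma>" for n
  have N: "real_distribution (N n)" for n
    unfolding N_def by (rule prob_space.real_distribution_distr[OF measure_pmf.prob_space_axioms]) simp
  have "weak_conv_m N std_normal_distribution"
    unfolding N_def using p by (rule de_Moivre_Laplace)
  then have conv: "(\<lambda>n. cdf (N n) x) \<longlonglongrightarrow> cdf std_normal_distribution x" for x
    by (simp add: weak_conv_m_def weak_conv_def isCont_cdf_std_normal)
  have eq: "?P n = cdf (N n) (a n)" if "n > 0" for n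
  proof -
    define r where "r = sqrt (real n)"
    have r: "r > 0" "real n = r * r" using that by (simp_all add: r_def)
    have "L * (real k - real n * \<kappa>) \<le> c * r \<longleftrightarrow> (real k - real n * p) / (r * \<sigma>) \<le> a n" for k
    proof -
      have "(real k - real n * p) / (r * \<sigma>) \<le> a n \<longleftrightarrow> real k - real n * p \<le> a n * (r * \<sigma>)"
        using r \<sigma> by (subst pos_divide_le_eq) auto
      also have "a n * (r * \<sigma>) = c * r / L + real n * (\<kappa> - p)"
        unfolding a_def using \<sigma> r L by (simp add: r_def[symmetric] field_simps)
      also have "real k - real n * p \<le> c * r / L + real n * (\<kappa> - p) \<longleftrightarrow>
          real k - real n * \<kappa> \<le> c * r / L"
        by (simp add: algebra_simps)
      also have "\<dots> \<longleftrightarrow> L * (real k - real n * \<kappa>) \<le> c * r"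
        using L by (simp add: pos_le_divide_eq mult.commute)
      finally show ?thesis by simp
    qed
    then show ?thesis
      by (simp add: cdf_def N_def measure_distr vimage_def r_def \<sigma>_def real_sqrt_mult)
  qed
  have sqrt_n: "filterlim (\<lambda>n. sqrt (real n)) at_top sequentially"
    by (intro filterlim_compose[OF sqrt_at_top] filterlim_real_sequentially)
  have "(\<lambda>n. cdf (N n) (a n)) \<longlonglongrightarrow> ?H"
  proof (cases \<kappa> p rule: linorder_cases)
    case less
    have "filterlim a at_bot sequentially"
    proof -
      have "filterlim (\<lambda>n. ((\<kappa> - p) / \<sigma>) * sqrt (real n)) at_bot sequentially"
        using less \<sigma> by (intro filterlim_tendsto_neg_mult_at_bot[OF tendsto_const _ sqrt_n])
          (simp add: divide_neg_pos)
      then have "filterlim (\<lambda>n. c / L / \<sigma> + ((\<kappa> - p) / \<sigma>) * sqrt (real n)) at_bot sequentially"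
        by (rule filterlim_tendsto_add_at_bot_iff[OF tendsto_const, THEN iffD2])
      then show ?thesis by (simp add: a_def[abs_def] add_divide_distrib mult.commute)
    qed
    from cdf_tendsto_0_of_at_bot[OF N real_dist_normal_dist conv this] less show ?thesis by simp
  next
    case greater
    have "filterlim a at_top sequentially"
    proof -
      have "filterlim (\<lambda>n. ((\<kappa> - p) / \<sigma>) * sqrt (real n)) at_top sequentially"
        using greater \<sigma> by (intro filterlim_tendsto_pos_mult_at_top[OF tendsto_const _ sqrt_n]) simp
      then have "filterlim (\<lambda>n. c / L / \<sigma> + ((\<kappa> - p) / \<sigma>) * sqrt (real n)) at_top sequentially"
        by (rule filterlim_tendsto_add_at_top[OF tendsto_const])
      then show ?thesis by (simp add: a_def[abs_def] add_divide_distrib mult.commute)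
    qed
    from cdf_tendsto_1_of_at_top[OF N real_dist_normal_dist conv this] greater show ?thesis by simp
  next
    case equal
    with conv show ?thesis by (simp add: a_def \<sigma>_def)
  qed
  then show ?thesis
    by (rule Lim_transform_eventually)
      (use eq in \<open>auto intro!: eventually_mono[OF eventually_gt_at_top[of 0]]\<close>)
qed

section \<open>The limit of the expected net profit\<close>

theorem theorem4p9:
  fixes p q u d :: real
    and M :: "nat \<Rightarrow> 'a measure"
    and X :: "nat \<Rightarrow> 'a \<Rightarrow> nat"
  assumes "0 < p" and "p < 1" and "q = 1 - p"
    and "0 < d" and "d \<le> 1" and "1 \<le> u" and "u \<noteq> d"
    and "\<And>n. n \<ge> 1 \<Longrightarrow> prob_space (M n)"
    and "\<And>n. n \<ge> 1 \<Longrightarrow> binomially_distributed (M n) n p (X n)"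
  shows "(\<lambda>n. expected_net_profit (M n) n u d (X n)) \<longlonglongrightarrow>
           (if u powr p * d powr q > 1 then 1
            else if u powr p * d powr q = 1 then 0
            else - 1)"
proof -
  define L where "L = ln (u / d)"
  define \<kappa> where "\<kappa> = ln (1 / d) / L"
  define H where "H c = (if \<kappa> < p then 0 else if p < \<kappa> then 1
      else cdf std_normal_distribution (c / (L * sqrt (p * (1 - p)))))" for c
  have L: "0 < L" unfolding L_def using assms by (intro ln_gt_zero) simp
  have "p * ln u + q * ln d = L * (p - \<kappa>)"
    using assms L by (simp add: \<kappa>_def right_diff_distrib) (simp add: L_def ln_div algebra_simps)
  then have "u powr p * d powr q = exp (L * (p - \<kappa>))"
    using assms by (simp add: powr_def exp_add[symmetric])
  then have rhs: "(if u powr p * d powr q > 1 then 1 else if u powr p * d powr q = 1 then 0 else - 1)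
      = 1 - 2 * H 0"
    using L by (auto simp: H_def cdf_std_normal_0 zero_less_mult_iff)
  have H: "(H \<longlongrightarrow> H 0) (at_left 0)"
  proof -
    have "isCont (\<lambda>c. cdf std_normal_distribution (c / (L * sqrt (p * (1 - p))))) 0"
      using L assms(1,2) by (intro isCont_o2[OF _ isCont_cdf_std_normal] continuous_intros) simp
    then have "isCont H 0"
      unfolding H_def[abs_def] by (cases \<kappa> p rule: linorder_cases) simp_all
    then show ?thesis
      by (auto simp: isCont_def intro: tendsto_within_subset)
  qed
  have "(\<lambda>n. measure_pmf.expectation (binomial_pmf n p)
      (\<lambda>k. capped_payoff (L * (real k - real n * \<kappa>)))) \<longlonglongrightarrow> 1 - 2 * H 0"
    by (rule expectation_capped_payoff_tendsto[OF measure_pmf.prob_space_axioms _ _ H])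
      (use binomial_prob_tendsto[OF assms(1,2) L, of \<kappa>] in \<open>simp_all add: H_def\<close>)
  then show ?thesis
    unfolding rhs
  proof (rule Lim_transform_eventually)
    show "eventually (\<lambda>n. measure_pmf.expectation (binomial_pmf n p)
        (\<lambda>k. capped_payoff (L * (real k - real n * \<kappa>))) =
        expected_net_profit (M n) n u d (X n)) sequentially"
      using eventually_ge_at_top[of "1::nat"]
      by eventually_elim
        (simp add: expected_net_profit_eq[OF assms(1,2,4-7) assms(9)] L_def \<kappa>_def)
  qed
qed

end
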